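(* Let $0<\mu=\lambda_1\le\lambda_2\le\dots\le\lambda_d=L$ be the eigenvalues of a symmetric positive definite matrix $Q\in\mathbb{R}^{d\times d}$, and let $\rho(\alpha)$ and $\mathcal{J}(\alpha)$ be given by $$\rho(\alpha)=\max\{|1-\alpha\mu|,|1-\alpha L|\},\qquad \mathcal{J}(\alpha)=\sum_{i=1}^d\frac{\alpha^2\lambda_i}{2(1-(1-\alpha\lambda_i)^2)}=\alpha\sum_{i=1}^d\frac{1}{2(2-\alpha\lambda_i)}.$$ Then the inequality $$\mathcal{J}(\alpha)\ge\left(1-\rho^2(\alpha)\right)\sum_{i=1}^d\frac{1}{8\lambda_i}$$ holds for any choice of the stepsize $\alpha>0$.
   Context: $Q$ is the Hessian of a strongly convex quadratic function $f(x)=\tfrac12x^\top Qx-p^\top x+r$. $\rho(\alpha)$ is the spectral radius of $I_d-\alpha Q$ (the convergence rate of gradient descent with constant stepsize $\alpha$). For $\alpha\in(0,2/L)$, $\mathcal{J}(\alpha)$ is the robustness of gradient descent, i.e. the limit $\lim_{k\to\infty}\frac{1}{\sigma^2}\mathbb{E}[f(x_k)-\min f]$ for the iterates $x_{k+1}=x_k-\alpha(\nabla f(x_k)+w_k)$ with zero-mean gradient noise $w_k$, independent of the iterates up to time $k$, with covariance $\sigma^2I_d$.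
   Formalization: The displayed formula for J(α) is used only for 0<α<2/L; for α≥2/L, J(α) is set to +∞ (the robustness limit diverges), since with the formula the inequality fails there, e.g. d=1, λ=1, α=3 gives J=−1.5 but right side −0.375. *)

theory Defs
  imports
    Jordan_Normal_Form.Char_Poly
    "HOL-Library.Extended_Real"
begin

definition sym_pos_def :: "nat \<Rightarrow> real mat \<Rightarrow> bool" where
  "sym_pos_def d Q \<longleftrightarrow>
     Q \<in> carrier_mat d d \<and> transpose_mat Q = Q \<and>
     (\<forall>v \<in> carrier_vec d. v \<noteq> 0\<^sub>v d \<longrightarrow> 0 < v \<bullet> (Q *\<^sub>v v))"

(* lam 1 \<le> ... \<le> lam d are the eigenvalues of Q, repeated according to multiplicity. *)
definition ordered_eigenvalues :: "nat \<Rightarrow> real mat \<Rightarrow> (nat \<Rightarrow> real) \<Rightarrow> bool" where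
  "ordered_eigenvalues d Q lam \<longleftrightarrow>
     mono_on {1..d} lam \<and> char_poly Q = (\<Prod>i = 1..d. [:- lam i, 1:])"

definition gd_rate :: "real \<Rightarrow> real \<Rightarrow> real \<Rightarrow> real" where
  "gd_rate \<mu> L \<alpha> = max \<bar>1 - \<alpha> * \<mu>\<bar> \<bar>1 - \<alpha> * L\<bar>"

(* Only for 0 < \<alpha> < 2 / L, with L = lam d, is the sum the limit of E[f(x_k) - min f] / \<sigma>^2.
   For \<alpha> \<ge> 2 / L that limit is infinite: the noise variance along an eigenvector for L obeys
   v_{k+1} = (1 - \<alpha> L)^2 v_k + \<alpha>^2 \<sigma>^2 with (1 - \<alpha> L)^2 \<ge> 1.  There the sum, which may have
   vanishing denominators or negative terms, is meaningless, and the value is set to \<infinity>. *)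
definition gd_robustness :: "nat \<Rightarrow> (nat \<Rightarrow> real) \<Rightarrow> real \<Rightarrow> ereal" where
  "gd_robustness d lam \<alpha> =
     (if \<alpha> < 2 / lam d
      then ereal (\<Sum>i = 1..d. \<alpha>\<^sup>2 * lam i / (2 * (1 - (1 - \<alpha> * lam i)\<^sup>2)))
      else \<infinity>)"

end

theory Submission
  imports Defs
begin

text \<open>The inequality holds term by term. For an eigenvalue x between \<mu> and L, the rate
  bounds |1 - \<alpha> x|, so 1 - \<rho>^2 is at most \<alpha> x s with s = 2 - \<alpha> x
  (\<open>one_minus_gd_rate_sq_le\<close>). Dividing by 8 x leaves \<alpha> s / 8, while the
  robustness summand is \<alpha> / (2 s); since 0 < s \<le> 2, the former is at most the latter
  (\<open>rate_summand_le_robustness_summand\<close>). Summing over the eigenvalues settles \<alpha>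
  < 2 / L; for larger stepsizes the robustness is infinite. Positive definiteness enters only
  through the positivity of the eigenvalues.\<close>

lemma sym_pos_def_eigenvalue_pos:
  assumes "sym_pos_def d Q" and "eigenvalue Q k"
  shows "0 < k"
proof -
  have Q: "Q \<in> carrier_mat d d"
    and pos: "\<And>v. v \<in> carrier_vec d \<Longrightarrow> v \<noteq> 0\<^sub>v d \<Longrightarrow> 0 < v \<bullet> (Q *\<^sub>v v)"
    using assms(1) unfolding sym_pos_def_def by auto
  obtain v where v: "v \<in> carrier_vec d" "v \<noteq> 0\<^sub>v d" and ev: "Q *\<^sub>v v = k \<cdot>\<^sub>v v"
    using assms(2) Q unfolding eigenvalue_def eigenvector_def by auto
  \<comment> \<open>The quadratic form at an eigenvector is the eigenvalue times the squared
    norm.\<close>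
  have "0 < k * (v \<bullet> v)"
    using pos[OF v] v(1) by (simp add: ev)
  moreover have "0 \<le> v \<bullet> v"
    by (simp add: scalar_prod_def sum_nonneg)
  ultimately show "0 < k"
    by (simp add: zero_less_mult_iff)
qed

lemma ordered_eigenvalues_pos:
  assumes "sym_pos_def d Q" and "ordered_eigenvalues d Q lam" and "i \<in> {1..d}"
  shows "0 < lam i"
proof -
  have Q: "Q \<in> carrier_mat d d"
    using assms(1) unfolding sym_pos_def_def by simp
  have "poly (char_poly Q) (lam i) = 0"
    using assms(2,3) unfolding ordered_eigenvalues_def by (auto simp: poly_prod)
  then have "eigenvalue Q (lam i)"
    using eigenvalue_root_char_poly[OF Q] by simp
  then show ?thesis
    using sym_pos_def_eigenvalue_pos assms(1) by blast
qed

text \<open>1 - \<alpha> x lies between 1 - \<alpha> L and 1 - \<alpha> \<mu>, so its absolute value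
  is at most the larger of the absolute values of these two. Squaring gives the claim, as 1 - (1 -
  \<alpha> x)^2 = \<alpha> x (2 - \<alpha> x).\<close>

lemma one_minus_gd_rate_sq_le:
  assumes "0 \<le> \<alpha>" and "\<mu> \<le> x" and "x \<le> L"
  shows "1 - (gd_rate \<mu> L \<alpha>)\<^sup>2 \<le> \<alpha> * x * (2 - \<alpha> * x)"
proof -
  have "\<alpha> * \<mu> \<le> \<alpha> * x" "\<alpha> * x \<le> \<alpha> * L"
    using assms by (auto intro: mult_left_mono)
  then have "\<bar>1 - \<alpha> * x\<bar> \<le> gd_rate \<mu> L \<alpha>"
    unfolding gd_rate_def by linarith
  then have "(1 - \<alpha> * x)\<^sup>2 \<le> (gd_rate \<mu> L \<alpha>)\<^sup>2"
    by (metis abs_ge_zero power2_abs power_mono)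
  then show ?thesis
    by (simp add: power2_eq_square algebra_simps)
qed

text \<open>The denominator contains the nonzero factor \<alpha> x, which cancels against the
  numerator.\<close>

lemma gd_robustness_summand_eq:
  fixes \<alpha> x :: real
  assumes "0 < \<alpha>" and "0 < x" and "\<alpha> * x < 2"
  shows "\<alpha>\<^sup>2 * x / (2 * (1 - (1 - \<alpha> * x)\<^sup>2)) = \<alpha> * (1 / (2 * (2 - \<alpha> * x)))"
proof -
  have "1 - (1 - \<alpha> * x)\<^sup>2 = \<alpha> * x * (2 - \<alpha> * x)"
    by (simp add: power2_eq_square algebra_simps)
  then show ?thesis
    using assms by (simp add: power2_eq_square)
qed

lemma rate_summand_le_robustness_summand:
  fixes \<alpha> x c :: real
  assumes "0 < \<alpha>" and "0 < x" and "\<alpha> * x < 2" and c: "c \<le> \<alpha> * x * (2 - \<alpha> * x)"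
  shows "c * (1 / (8 * x)) \<le> \<alpha> * (1 / (2 * (2 - \<alpha> * x)))"
proof -
  define s where "s = 2 - \<alpha> * x"
  have s: "0 < s" "s \<le> 2"
    using assms by (auto simp: s_def)
  have "c * (1 / (8 * x)) \<le> \<alpha> * x * s * (1 / (8 * x))"
    using c assms(2) by (intro mult_right_mono) (auto simp: s_def)
  also have "\<dots> = \<alpha> * (s / 8)"
    using assms(2) by simp
  also have "\<dots> \<le> \<alpha> * (1 / (2 * s))"
  proof (intro mult_left_mono)
    \<comment> \<open>After clearing the positive denominators, s / 8 \<le> 1 / (2 s) says exactly
      s^2 \<le> 4.\<close>
    have "s * s \<le> 2 * 2"
      using s by (intro mult_mono) auto
    then show "s / 8 \<le> 1 / (2 * s)"
      using s by (simp add: field_simps)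
  qed (use assms(1) in simp)
  finally show ?thesis
    by (simp add: s_def)
qed

theorem proposition3p5:
  fixes d :: nat and Q :: "real mat" and lam :: "nat \<Rightarrow> real" and \<mu> L \<alpha> :: real
  assumes "1 \<le> d"
    and "sym_pos_def d Q"
    and "ordered_eigenvalues d Q lam"
    and "\<mu> = lam 1" and "L = lam d"
    and "0 < \<alpha>"
  shows "(\<alpha> < 2 / L \<longrightarrow>
           gd_robustness d lam \<alpha> = ereal (\<alpha> * (\<Sum>i = 1..d. 1 / (2 * (2 - \<alpha> * lam i))))) \<and>
         gd_robustness d lam \<alpha> \<ge>
           ereal ((1 - (gd_rate \<mu> L \<alpha>)\<^sup>2) * (\<Sum>i = 1..d. 1 / (8 * lam i)))"
proof (cases "\<alpha> < 2 / L")
  \<comment> \<open>Here the robustness is \<infinity> by definition: the implication is vacuous and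
    the bound trivial.\<close>
  case False
  then show ?thesis
    using assms(5) by (simp add: gd_robustness_def)
next
  case True
  have pos: "0 < lam i" if "i \<in> {1..d}" for i
    using ordered_eigenvalues_pos assms(2,3) that by blast
  have mono: "mono_on {1..d} lam"
    using assms(3) unfolding ordered_eigenvalues_def by simp
  have ge: "\<mu> \<le> lam i" and le: "lam i \<le> L" if "i \<in> {1..d}" for i
    using mono_onD[OF mono, of 1 i] mono_onD[OF mono, of i d] that assms(1,4,5) by auto
  \<comment> \<open>Since 1 \<le> d, the index d is in range, so L = \<open>lam d\<close> is
    positive and can be multiplied out. As L is the largest eigenvalue, every 2 - \<alpha> *
    \<open>lam i\<close> is then positive.\<close>
  have "\<alpha> * L < 2"
    using True pos[of d] assms(1,5) by (simp add: field_simps)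
  then have lt: "\<alpha> * lam i < 2" if "i \<in> {1..d}" for i
    using mult_left_mono[OF le[OF that], of \<alpha>] assms(6) by linarith
  have "(\<Sum>i = 1..d. \<alpha>\<^sup>2 * lam i / (2 * (1 - (1 - \<alpha> * lam i)\<^sup>2)))
      = \<alpha> * (\<Sum>i = 1..d. 1 / (2 * (2 - \<alpha> * lam i)))"
    unfolding sum_distrib_left
    by (intro sum.cong refl gd_robustness_summand_eq assms(6) pos lt)
  then have eq: "gd_robustness d lam \<alpha> = ereal (\<alpha> * (\<Sum>i = 1..d. 1 / (2 * (2 - \<alpha> * lam i))))"
    using True assms(5) by (simp add: gd_robustness_def)
  have "(1 - (gd_rate \<mu> L \<alpha>)\<^sup>2) * (\<Sum>i = 1..d. 1 / (8 * lam i))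
      \<le> \<alpha> * (\<Sum>i = 1..d. 1 / (2 * (2 - \<alpha> * lam i)))"
    unfolding sum_distrib_left
    by (intro sum_mono rate_summand_le_robustness_summand one_minus_gd_rate_sq_le
        less_imp_le[OF assms(6)] assms(6) pos lt ge le)
  then show ?thesis
    using eq by simp
qed

end
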